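(* Let $H_0$ be the solution of $H_0'' = -Q(t)^2H_0$ for $t > 0$ with $H_0(0) = 0$, $H_0'(0) = -1$, and let $\tau_0 > 0$ be its first positive zero. Let $p$ solve $$p''(t) = -Q(t+\tau_0)^2\,p(t), \quad t > 0, \qquad p(0) = 0,\ p'(0) = 1.$$ Then $p(t) > 0$ for all $0 < t < \infty$. Furthermore, there is a constant $c_1 > 0$ with $\min_{t \ge 1} p(t) \ge c_1$.
   Context: $Q(t)$, $t\ge 0$, denotes the radial profile of the positive radial ground state of $\Delta\phi - \phi + |\phi|^2\phi = 0$ on $\mathbb{R}^3$; it solves $-Q'' - \frac{2}{t}Q' + Q - Q^3 = 0$. The first positive zero $\tau_0$ of $H_0$ exists; this is the case $\epsilon = 0$ of the paper's sign-change lemma for $H_\epsilon$. *)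

theory Defs
  imports "HOL-Analysis.Analysis"
begin

text \<open>Radial profile of the positive radial ground state of
  \<Delta>phi - phi + |phi|^2 phi = 0 on R^3:
  Q > 0 on [0,oo), C^1 on [0,oo) with Q'(0) = 0 (regularity at the origin),
  Q'' = Q - Q^3 - (2/t) Q' for t > 0, and Q(t) -> 0 as t -> oo.\<close>
definition ground_state_profile :: "(real \<Rightarrow> real) \<Rightarrow> bool" where
  "ground_state_profile Q \<longleftrightarrow>
     (\<exists>Q'. (\<forall>t\<ge>0. (Q has_real_derivative Q' t) (at t within {0..}))
         \<and> Q' 0 = 0
         \<and> (\<forall>t>0. (Q' has_real_derivative (Q t - Q t ^ 3 - 2 / t * Q' t)) (at t))
         \<and> (\<forall>t\<ge>0. Q t > 0)
         \<and> (Q \<longlongrightarrow> 0) at_top)"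

definition solves_lin_ode ::
  "(real \<Rightarrow> real) \<Rightarrow> (real \<Rightarrow> real) \<Rightarrow> real \<Rightarrow> real \<Rightarrow> bool" where
  "solves_lin_ode V y y0 y1 \<longleftrightarrow>
     (\<exists>y'. (\<forall>t\<ge>0. (y has_real_derivative y' t) (at t within {0..}))
         \<and> (\<forall>t>0. (y' has_real_derivative (V t * y t)) (at t))
         \<and> y 0 = y0 \<and> y' 0 = y1)"

end

theory Submission
  imports Defs
begin

text \<open>
  The function \<open>f(t) = t (1 - Q(t))\<close> satisfies \<open>f'' = - (Q\<^sup>2 + Q) f\<close>, so it oscillates strictly
  faster than \<open>H\<^sub>0\<close> and \<open>p\<close>, and its sign is that of \<open>1 - Q\<close>. The energy
  \<open>Q'\<^sup>2/2 + Q\<^sup>4/4 - Q\<^sup>2/2\<close> decreases to a nonnegative limit, so \<open>Q\<close> has no critical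
  point at height at most 1; hence \<open>Q - 1\<close> changes sign once, from plus to minus. Since \<open>f(0) = 0\<close>,
  Sturm comparison on \<open>(0, \<tau>\<^sub>0)\<close> forces \<open>Q(\<tau>\<^sub>0) \<le> 1\<close>, so \<open>f > 0\<close> on
  \<open>(\<tau>\<^sub>0, \<infinity>)\<close>, and Sturm comparison there shows that \<open>p\<close> has no further zero. A positive
  concave function on a half-line is nondecreasing, which gives the lower bound.
\<close>

section \<open>One-sided behaviour at the origin and Sturm comparison\<close>

lemma at_within_Ici_pos:
  fixes t :: real
  assumes "0 < t"
  shows "at t within {0..} = at t"
  using assms by (intro at_within_interior) simp

lemma tendsto_at_right_0:
  fixes y :: "real \<Rightarrow> real"
  assumes "(y has_real_derivative l) (at 0 within {0..})"
  shows "(y \<longlongrightarrow> y 0) (at_right 0)"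
proof -
  have "(y \<longlongrightarrow> y 0) (at 0 within {0..})"
    using DERIV_continuous[OF assms] by (simp add: continuous_within)
  then show ?thesis by (rule tendsto_within_subset) auto
qed

text \<open>The Wronskian hypothesis is only required along some sequence tending to \<open>a\<close>, so no
  continuity of the derivatives at \<open>a\<close> is needed.\<close>

lemma sturm_comparison:
  fixes y f y' f' U V :: "real \<Rightarrow> real"
  assumes "a < b"
    and dy: "\<And>t. a < t \<Longrightarrow> t \<le> b \<Longrightarrow> (y has_real_derivative y' t) (at t)"
    and dy': "\<And>t. a < t \<Longrightarrow> t \<le> b \<Longrightarrow> (y' has_real_derivative - V t * y t) (at t)"
    and df: "\<And>t. a < t \<Longrightarrow> t \<le> b \<Longrightarrow> (f has_real_derivative f' t) (at t)"
    and df': "\<And>t. a < t \<Longrightarrow> t \<le> b \<Longrightarrow> (f' has_real_derivative - U t * f t) (at t)"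
    and pos: "\<And>t. a < t \<Longrightarrow> t < b \<Longrightarrow> y t > 0 \<and> f t > 0 \<and> V t < U t"
    and yb: "y b = 0" and fb: "f b \<ge> 0"
    and W0: "\<And>e s. e > 0 \<Longrightarrow> a < s \<Longrightarrow> \<exists>\<xi>. a < \<xi> \<and> \<xi> < s \<and> f \<xi> * y' \<xi> - f' \<xi> * y \<xi> > - e"
  shows False
proof -
  \<comment> \<open>The Wronskian. The equations give W' = (U - V) f y, positive on the open
    interval, while W(b) \<le> 0; so W stays below a negative constant near \<open>a\<close>,
    against \<open>W0\<close>.\<close>
  define W where "W t = f t * y' t - f' t * y t" for t
  have dW: "(W has_real_derivative (U t - V t) * (f t * y t)) (at t)" if "a < t" "t \<le> b" for t
    unfolding W_def
    by (rule derivative_eq_intros dy dy' df df' that refl)+ (simp add: algebra_simps)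
  have incr: "W s < W t" if "a < s" "s < t" "t \<le> b" for s t
  proof (rule DERIV_pos_imp_increasing_open[OF \<open>s < t\<close>])
    show "\<exists>y. (W has_real_derivative y) (at x) \<and> 0 < y" if "s < x" "x < t" for x
      using dW[of x] pos[of x] that \<open>a < s\<close> \<open>t \<le> b\<close> by (intro exI[of _ "(U x - V x) * (f x * y x)"]) auto
    show "continuous_on {s..t} W"
      using dW that by (intro DERIV_atLeastAtMost_imp_continuous_on) (meson less_le_trans order_trans)
  qed
  \<comment> \<open>\<open>y\<close> comes down to 0 from positive values; a positive slope at
    \<open>b\<close> would make it negative just to the left.\<close>
  have "y' b \<le> 0"
  proof (rule ccontr)
    assume "\<not> y' b \<le> 0"
    then obtain d where d: "d > 0" "\<And>h. h > 0 \<Longrightarrow> h < d \<Longrightarrow> y (b - h) < y b"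
      using DERIV_pos_inc_left[OF dy[of b]] \<open>a < b\<close> by auto
    have "y (b - min (d/2) ((b - a)/2)) < 0"
      using d(2)[of "min (d/2) ((b - a)/2)"] d(1) \<open>a < b\<close> yb by (simp add: min_def split: if_splits)
    moreover have "y (b - min (d/2) ((b - a)/2)) > 0"
      using pos[of "b - min (d/2) ((b - a)/2)"] d(1) \<open>a < b\<close> by (auto simp: min_def field_simps)
    ultimately show False by simp
  qed
  then have Wb: "W b \<le> 0"
    using fb yb by (simp add: W_def mult_nonneg_nonpos)
  define m where "m = (a + b) / 2"
  have m: "a < m" "m < b" using \<open>a < b\<close> by (auto simp: m_def)
  then have "W m < 0" using incr[of m b] Wb by simp
  then obtain \<xi> where "a < \<xi>" "\<xi> < m" "W \<xi> > W m"
    using W0[of "- W m" m] m unfolding W_def by auto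
  then show False using incr[of \<xi> m] m by simp
qed

section \<open>Initial sign and first zero of a solution\<close>

lemma pos_right_if_deriv_pos:
  fixes y :: "real \<Rightarrow> real"
  assumes "(y has_real_derivative l) (at 0 within {0..})" "y 0 = 0" "l > 0"
  obtains d where "d > 0" "\<And>t. 0 < t \<Longrightarrow> t < d \<Longrightarrow> y t > 0"
  using has_real_derivative_pos_inc_right[OF assms(1,3)] assms(2) by force

lemma pos_if_no_zero:
  fixes y :: "real \<Rightarrow> real"
  assumes c: "continuous_on {0..} y" and d: "d > 0" "\<And>t. 0 < t \<Longrightarrow> t < d \<Longrightarrow> y t > 0"
    and nz: "\<And>t. 0 < t \<Longrightarrow> t < b \<Longrightarrow> y t \<noteq> 0" and t: "0 < t" "t < b"
  shows "y t > 0"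
proof (rule ccontr)
  assume n: "\<not> y t > 0"
  then have "d \<le> t" using d t by (meson not_le)
  then have "\<exists>x\<ge>d/2. x \<le> t \<and> y x = 0"
    using n d(1) d(2)[of "d/2"]
    by (intro IVT2') (auto intro: continuous_on_subset[OF c])
  then show False using nz d(1) t by force
qed

lemma first_zero:
  fixes y :: "real \<Rightarrow> real"
  assumes c: "continuous_on {0..} y" and d: "d > 0" "\<And>t. 0 < t \<Longrightarrow> t < d \<Longrightarrow> y t > 0"
    and T: "T > 0" "y T \<le> 0"
  obtains z where "z > 0" "y z = 0" "\<And>t. 0 < t \<Longrightarrow> t < z \<Longrightarrow> y t > 0"
proof -
  \<comment> \<open>Starting at \<open>d/2\<close> excludes a possible zero at the origin, so the
    compact set \<open>Z\<close> has a positive least element.\<close>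
  define Z where "Z = {t \<in> {d/2..T}. y t = 0}"
  have "d \<le> T" using d T by (meson not_le)
  then have "\<exists>x\<ge>d/2. x \<le> T \<and> y x = 0"
    using T d(1) d(2)[of "d/2"]
    by (intro IVT2') (auto intro: continuous_on_subset[OF c])
  then have "Z \<noteq> {}" by (auto simp: Z_def)
  moreover have "compact Z"
  proof -
    have "closed Z" unfolding Z_def
      by (rule continuous_closed_preimage_constant)
         (use d(1) in \<open>auto intro: continuous_on_subset[OF c]\<close>)
    moreover have "bounded Z" by (rule bounded_subset[of "{d/2..T}"]) (auto simp: Z_def)
    ultimately show ?thesis by (simp add: compact_eq_bounded_closed)
  qed
  ultimately obtain z where z: "z \<in> Z" "\<And>t. t \<in> Z \<Longrightarrow> z \<le> t"
    using compact_attains_inf by metis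
  have nz: "y t \<noteq> 0" if "0 < t" "t < z" for t
  proof (cases "t < d")
    case True
    then show ?thesis using d that by force
  next
    case False
    then show ?thesis using z(2)[of t] z(1) that d(1) by (auto simp: Z_def)
  qed
  show thesis
  proof (rule that)
    show "z > 0" "y z = 0" using z(1) d(1) by (auto simp: Z_def)
    show "y t > 0" if "0 < t" "t < z" for t
      using pos_if_no_zero[OF c d nz that] .
  qed
qed

section \<open>Energy and the single crossing of height 1\<close>

locale ground_state =
  fixes Q Q' :: "real \<Rightarrow> real"
  assumes Q_deriv_within: "\<And>t. t \<ge> 0 \<Longrightarrow> (Q has_real_derivative Q' t) (at t within {0..})"
    and Q'_0: "Q' 0 = 0"
    and Q'_deriv: "\<And>t. t > 0 \<Longrightarrow> (Q' has_real_derivative (Q t - Q t ^ 3 - 2 / t * Q' t)) (at t)"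
    and Q_pos: "\<And>t. t \<ge> 0 \<Longrightarrow> Q t > 0"
    and Q_tendsto_0: "(Q \<longlongrightarrow> 0) at_top"
begin

lemma Q_deriv: "t > 0 \<Longrightarrow> (Q has_real_derivative Q' t) (at t)"
  using Q_deriv_within[of t] by (simp add: at_within_Ici_pos)

lemma Q_continuous: "continuous_on {0..} Q"
  using Q_deriv_within by (intro DERIV_continuous_on) auto

text \<open>The friction term 2/t Q' makes the energy nonincreasing. Its potential part at any later
  s is therefore at most the energy at t, and that part tends to 0 with \<open>Q\<close>; no decay
  of \<open>Q'\<close> enters.\<close>

lemma energy_nonneg:
  assumes "t > 0"
  shows "(Q' t)\<^sup>2 / 2 + Q t ^ 4 / 4 - (Q t)\<^sup>2 / 2 \<ge> 0"
proof -
  define E where "E t = (Q' t)\<^sup>2 / 2 + Q t ^ 4 / 4 - (Q t)\<^sup>2 / 2" for t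
  have dE: "(E has_real_derivative - 2 / t * (Q' t)\<^sup>2) (at t)" if "t > 0" for t
  proof -
    have "(E has_real_derivative 2 * Q' t * (Q t - Q t ^ 3 - 2 / t * Q' t) / 2
        + 4 * Q t ^ 3 * Q' t / 4 - 2 * Q t * Q' t / 2) (at t)"
      unfolding E_def
      by (intro DERIV_diff DERIV_add DERIV_cdivide)
         (use DERIV_power[OF Q'_deriv[OF that], of 2] DERIV_power[OF Q_deriv[OF that], of 2]
            DERIV_power[OF Q_deriv[OF that], of 4] in \<open>simp_all add: mult_ac\<close>)
    moreover have "2 * Q' t * (Q t - Q t ^ 3 - 2 / t * Q' t) / 2
        + 4 * Q t ^ 3 * Q' t / 4 - 2 * Q t * Q' t / 2 = - 2 / t * (Q' t)\<^sup>2"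
      using that by (simp add: field_simps power2_eq_square)
    ultimately show ?thesis by simp
  qed
  have "E s \<le> E t" if "t \<le> s" for s
  proof (rule DERIV_nonpos_imp_nonincreasing[OF that])
    fix x assume "t \<le> x" "x \<le> s"
    then show "\<exists>y. (E has_real_derivative y) (at x) \<and> y \<le> 0"
      using dE[of x] assms by (intro exI[of _ "- 2 / x * (Q' x)\<^sup>2"]) auto
  qed
  then have "Q s ^ 4 / 4 - (Q s)\<^sup>2 / 2 \<le> E t" if "t \<le> s" for s
    using that unfolding E_def by (smt (verit) divide_nonneg_pos zero_le_power2)
  then have "\<forall>\<^sub>F s in at_top. Q s ^ 4 / 4 - (Q s)\<^sup>2 / 2 \<le> E t"
    by (meson eventually_at_top_linorderI)
  moreover have "((\<lambda>s. Q s ^ 4 / 4 - (Q s)\<^sup>2 / 2) \<longlongrightarrow> 0 ^ 4 / 4 - 0\<^sup>2 / 2) at_top"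
    by (intro tendsto_intros Q_tendsto_0) auto
  ultimately have "0 ^ 4 / 4 - 0\<^sup>2 / 2 \<le> E t"
    by (intro tendsto_upperbound) auto
  then show ?thesis by (simp add: E_def)
qed

text \<open>At a critical point the energy is -Q^2 (2 - Q^2) / 4, which is negative for 0 < Q \<le>
  1.\<close>

lemma no_critical_point_below:
  assumes "t > 0" "Q t \<le> 1"
  shows "Q' t \<noteq> 0"
proof
  assume "Q' t = 0"
  then have "(Q t)\<^sup>2 * (2 - (Q t)\<^sup>2) \<le> 0"
    using energy_nonneg[OF assms(1)] by (simp add: algebra_simps power2_eq_square power4_eq_xxxx)
  moreover have "Q t > 0" using Q_pos assms by simp
  moreover have "(Q t)\<^sup>2 \<le> 1" using \<open>Q t > 0\<close> assms(2) by (simp add: power_le_one)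
  ultimately show False by (simp add: mult_le_0_iff)
qed

text \<open>Stands in for continuity of \<open>Q'\<close> at 0: the difference quotients at 0 tend
  to \<open>Q' 0 = 0\<close>, and each one is a value of \<open>Q'\<close> by the mean value
  theorem.\<close>

lemma small_slope_near_0:
  assumes "e > 0" "s > 0"
  obtains \<xi> where "0 < \<xi>" "\<xi> < s" "\<bar>Q' \<xi>\<bar> < e"
proof -
  have "((\<lambda>t. (Q t - Q 0) / (t - 0)) \<longlongrightarrow> 0) (at 0 within {0..})"
    using Q_deriv_within[of 0] Q'_0 by (simp add: has_field_derivative_iff)
  then have "\<forall>\<^sub>F t in at 0 within {0..}. dist ((Q t - Q 0) / (t - 0)) 0 < e"
    using assms(1) by (rule tendstoD)
  then obtain d where d: "d > 0" "\<And>t. t > 0 \<Longrightarrow> t < d \<Longrightarrow> \<bar>(Q t - Q 0) / t\<bar> < e"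
    unfolding eventually_at by (auto simp: dist_real_def)
  define t where "t = min (d/2) s"
  have t: "t > 0" "t < d" "t \<le> s" using d(1) assms by (auto simp: t_def)
  obtain \<xi> where \<xi>: "0 < \<xi>" "\<xi> < t" "Q t - Q 0 = (t - 0) * Q' \<xi>"
  proof (rule mvt[of 0 t Q "\<lambda>x h. h * Q' x"])
    show "continuous_on {0..t} Q" by (rule continuous_on_subset[OF Q_continuous]) auto
    show "(Q has_derivative (\<lambda>h. h * Q' x)) (at x)" if "0 < x" "x < t" for x
      using Q_deriv[OF that(1)] by (simp only: has_field_derivative_def mult_commute_abs)
  qed (use t in auto)
  show thesis
    by (rule that[of \<xi>]) (use \<xi> t d(2)[of t] in auto)
qed

text \<open>The energy argument carried to the origin: if Q(0) \<le> 1, points of small slope near 0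
  would have negative energy.\<close>

lemma Q_0_gt_1: "Q 0 > 1"
proof (rule ccontr)
  assume "\<not> Q 0 > 1"
  then have Q0: "0 < Q 0" "Q 0 \<le> 1" using Q_pos by auto
  \<comment> \<open>Twice the energy is Q'^2 - G.\<close>
  define G where "G t = (Q t)\<^sup>2 - Q t ^ 4 / 2" for t
  have "(Q 0)\<^sup>2 * (2 - (Q 0)\<^sup>2) > 0"
    using Q0 power_le_one[of "Q 0" 2] by (intro mult_pos_pos) auto
  then have G0: "G 0 > 0" by (simp add: G_def algebra_simps power2_eq_square power4_eq_xxxx)
  have "continuous_on {0..} G" unfolding G_def by (intro continuous_intros Q_continuous) auto
  then have "(G \<longlongrightarrow> G 0) (at 0 within {0..})" by (simp add: continuous_on_def)
  then have "\<forall>\<^sub>F t in at 0 within {0..}. G t > G 0 / 2"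
    by (rule order_tendstoD) (use G0 in simp)
  then obtain d where d: "d > 0" "\<And>t. t > 0 \<Longrightarrow> t < d \<Longrightarrow> G t > G 0 / 2"
    unfolding eventually_at by (auto simp: dist_real_def)
  obtain \<xi> where \<xi>: "0 < \<xi>" "\<xi> < d" "\<bar>Q' \<xi>\<bar> < sqrt (G 0 / 2)"
    using small_slope_near_0[of "sqrt (G 0 / 2)" d] G0 d(1) by auto
  then have "(Q' \<xi>)\<^sup>2 < G 0 / 2"
    using power_strict_mono[OF \<xi>(3), of 2] G0 by simp
  then show False using energy_nonneg[OF \<xi>(1)] d(2)[OF \<xi>(1,2)] by (simp add: G_def)
qed

text \<open>A return to height 1 at \<open>b\<close> would give \<open>Q\<close> a minimum on [0,b]
  at an interior point of height at most 1, hence a forbidden critical point.\<close>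

lemma Q_stays_below_1:
  assumes "0 < a" "a < b" "Q a \<le> 1"
  shows "Q b < 1"
proof (rule ccontr)
  assume n: "\<not> Q b < 1"
  obtain m where m: "m \<in> {0..b}" "\<And>t. t \<in> {0..b} \<Longrightarrow> Q m \<le> Q t"
    using continuous_attains_inf[of "{0..b}" Q] continuous_on_subset[OF Q_continuous, of "{0..b}"] assms
    by auto
  \<comment> \<open>The minimum is not at 0, where \<open>Q\<close> exceeds 1. If it is at
    \<open>b\<close>, then Q(b) \<ge> 1 \<ge> Q(a) makes the interior point \<open>a\<close> a
    minimizer too.\<close>
  have "\<exists>x. 0 < x \<and> x < b \<and> Q x \<le> 1 \<and> (\<forall>t\<in>{0..b}. Q x \<le> Q t)"
  proof (cases "m = b")
    case True
    then show ?thesis using m n assms by (intro exI[of _ a]) force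
  next
    case False
    have "Q m \<le> 1" using m(2)[of a] assms by auto
    then have "m \<noteq> 0" using Q_0_gt_1 by auto
    then show ?thesis using m False \<open>Q m \<le> 1\<close> by (intro exI[of _ m]) auto
  qed
  then obtain x where x: "0 < x" "x < b" "Q x \<le> 1" "\<forall>t\<in>{0..b}. Q x \<le> Q t" by blast
  have "Q' x = 0"
    by (rule DERIV_local_min[OF Q_deriv[OF x(1)], of "min x (b - x)"]) (use x in \<open>simp_all add: abs_less_iff\<close>)
  then show False using no_critical_point_below x by blast
qed

section \<open>The comparison function and the two Sturm arguments\<close>

definition F :: "real \<Rightarrow> real" where "F t = t * (1 - Q t)"
definition F' :: "real \<Rightarrow> real" where "F' t = 1 - Q t - t * Q' t"

lemma F_deriv: "t > 0 \<Longrightarrow> (F has_real_derivative F' t) (at t)"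
  unfolding F_def F'_def by (rule derivative_eq_intros Q_deriv refl | assumption)+ simp

text \<open>The factor t absorbs the 2/t term, leaving F'' = t (Q^3 - Q); factoring Q^3 - Q = -(Q^2
  + Q)(1 - Q) makes this linear in \<open>F\<close>.\<close>

lemma F'_deriv:
  assumes "t > 0"
  shows "(F' has_real_derivative - ((Q t)\<^sup>2 + Q t) * F t) (at t)"
  unfolding F_def F'_def
  by (rule derivative_eq_intros Q_deriv Q'_deriv assms refl)+
     (use assms in \<open>simp add: field_simps power2_eq_square power3_eq_cube\<close>)

text \<open>Otherwise Q > 1 on all of (0,\<tau>], so \<open>- F\<close> is positive there. It
  vanishes at 0 like \<open>y\<close> but oscillates faster, so \<open>y\<close> could not reach its
  zero at \<tau> first.\<close>

lemma Q_le_1_at_zero: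
  assumes dy: "\<And>t. t \<ge> 0 \<Longrightarrow> (y has_real_derivative y' t) (at t within {0..})"
    and dy': "\<And>t. t > 0 \<Longrightarrow> (y' has_real_derivative - (Q t)\<^sup>2 * y t) (at t)"
    and y0: "y 0 = 0" and "\<tau> > 0" and y\<tau>: "y \<tau> = 0"
    and pos: "\<And>t. 0 < t \<Longrightarrow> t < \<tau> \<Longrightarrow> y t > 0"
  shows "Q \<tau> \<le> 1"
proof (rule ccontr)
  assume n: "\<not> Q \<tau> \<le> 1"
  have Q1: "Q t > 1" if "0 < t" "t \<le> \<tau>" for t
    using Q_stays_below_1[of t \<tau>] that n by (smt (verit))
  have y_lim: "(y \<longlongrightarrow> 0) (at_right 0)"
    using tendsto_at_right_0[OF dy[of 0]] y0 by simp
  have Q_lim: "(Q \<longlongrightarrow> Q 0) (at_right 0)"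
    using tendsto_at_right_0[OF Q_deriv_within[of 0]] by simp
  \<comment> \<open>\<open>y\<close> is concave on (0,\<tau>), so \<open>C\<close> bounds
    \<open>y'\<close> from below near 0. A lower bound suffices, since \<open>y'\<close> enters the
    Wronskian with the positive factor \<open>- F\<close>.\<close>
  define C where "C = y' (\<tau>/2)"
  have y'_ge: "y' t \<ge> C" if "0 < t" "t < \<tau>/2" for t
    unfolding C_def
  proof (rule DERIV_nonpos_imp_nonincreasing[of t "\<tau>/2" y'])
    show "\<exists>z. (y' has_real_derivative z) (at x) \<and> z \<le> 0" if "t \<le> x" "x \<le> \<tau>/2" for x
      using dy'[of x] pos[of x] that \<open>0 < t\<close> \<open>\<tau> > 0\<close> by (intro exI[of _ "- (Q x)\<^sup>2 * y x"]) auto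
  qed (use that in simp)
  show False
  proof (rule sturm_comparison[of 0 \<tau> y y' "\<lambda>t. (Q t)\<^sup>2" "\<lambda>t. - F t" "\<lambda>t. - F' t" "\<lambda>t. (Q t)\<^sup>2 + Q t"])
    show "(y has_real_derivative y' t) (at t)" if "0 < t" for t
      using dy[of t] that by (simp add: at_within_Ici_pos)
    show "((\<lambda>t. - F t) has_real_derivative - F' t) (at t)" if "0 < t" for t
      using F_deriv[OF that] by (rule DERIV_minus)
    show "((\<lambda>t. - F' t) has_real_derivative - ((Q t)\<^sup>2 + Q t) * - F t) (at t)" if "0 < t" for t
      using DERIV_minus[OF F'_deriv[OF that]] by simp
    show "y t > 0 \<and> - F t > 0 \<and> (Q t)\<^sup>2 < (Q t)\<^sup>2 + Q t" if "0 < t" "t < \<tau>" for t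
      using pos[OF that] Q1[of t] that by (auto simp: F_def mult_pos_neg)
    show "- F \<tau> \<ge> 0" using Q1[of \<tau>] \<open>\<tau> > 0\<close> by (simp add: F_def mult_nonneg_nonpos)
    show "\<exists>\<xi>. 0 < \<xi> \<and> \<xi> < s \<and> - F \<xi> * y' \<xi> - - F' \<xi> * y \<xi> > - e" if "e > 0" "0 < s" for e s
    proof -
      \<comment> \<open>\<open>B\<close> is the Wronskian with \<open>y'\<close> replaced by
        \<open>C\<close> and \<open>Q'\<close> by 1. It is a lower bound wherever |Q'| < 1 near 0,
        and it tends to 0.\<close>
      define B where "B t = t * (Q t - 1) * C + (1 - Q t - t) * y t" for t
      have "(B \<longlongrightarrow> 0 * (Q 0 - 1) * C + (1 - Q 0 - 0) * 0) (at_right 0)"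
        unfolding B_def by (intro tendsto_intros Q_lim y_lim)
      then have "\<forall>\<^sub>F t in at_right 0. B t > - e"
        by (rule order_tendstoD) (use that in simp)
      then obtain d where d: "d > 0" "\<And>t. t > 0 \<Longrightarrow> t < d \<Longrightarrow> B t > - e"
        unfolding eventually_at_right_field by auto
      obtain \<xi> where \<xi>: "0 < \<xi>" "\<xi> < min (min d s) (\<tau>/2)" "\<bar>Q' \<xi>\<bar> < 1"
        using small_slope_near_0[of 1 "min (min d s) (\<tau>/2)"] d(1) \<open>0 < s\<close> \<open>\<tau> > 0\<close> by auto
      have "\<xi> * (Q \<xi> - 1) * C \<le> \<xi> * (Q \<xi> - 1) * y' \<xi>"
        using y'_ge[of \<xi>] Q1[of \<xi>] \<xi> by (intro mult_left_mono) auto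
      moreover have "\<xi> * Q' \<xi> \<le> \<xi> * 1"
        using \<xi> by (intro mult_left_mono) auto
      then have "(1 - Q \<xi> - \<xi>) * y \<xi> \<le> (1 - Q \<xi> - \<xi> * Q' \<xi>) * y \<xi>"
        using pos[of \<xi>] \<xi> by (intro mult_right_mono) auto
      ultimately have "B \<xi> \<le> - F \<xi> * y' \<xi> - - F' \<xi> * y \<xi>"
        by (simp add: B_def F_def F'_def algebra_simps)
      then show ?thesis using d(2)[of \<xi>] \<xi> by (intro exI[of _ \<xi>]) auto
    qed
  qed (use dy' \<open>\<tau> > 0\<close> y\<tau> in auto)
qed

text \<open>Past \<tau> the function \<open>F\<close> is positive and oscillates faster than
  \<open>p\<close>. At a first zero of \<open>p\<close> comparison gives a contradiction; at the
  left end the Wronskian is asymptotically nonnegative because F(\<tau>) \<ge> 0 and p(0) =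
  0.\<close>

lemma shifted_solution_pos:
  assumes dp: "\<And>t. t \<ge> 0 \<Longrightarrow> (p has_real_derivative p' t) (at t within {0..})"
    and dp': "\<And>t. t > 0 \<Longrightarrow> (p' has_real_derivative - (Q (t + \<tau>))\<^sup>2 * p t) (at t)"
    and p0: "p 0 = 0" and p'0: "p' 0 > 0" and "\<tau> > 0" and Q\<tau>: "Q \<tau> \<le> 1"
    and "t > 0"
  shows "p t > 0"
proof (rule ccontr)
  assume "\<not> p t > 0"
  have dp1: "(p has_real_derivative p' t) (at t)" if "0 < t" for t
    using dp[of t] that by (simp add: at_within_Ici_pos)
  have cp: "continuous_on {0..} p" using dp by (intro DERIV_continuous_on) auto
  obtain d where d: "d > 0" "\<And>t. 0 < t \<Longrightarrow> t < d \<Longrightarrow> p t > 0"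
    using pos_right_if_deriv_pos[OF dp[of 0] p0 p'0] by auto
  obtain z where z: "z > 0" "p z = 0" "\<And>t. 0 < t \<Longrightarrow> t < z \<Longrightarrow> p t > 0"
    using first_zero[OF cp d \<open>t > 0\<close>] \<open>\<not> p t > 0\<close> by (metis not_less)
  have Q1: "Q (t + \<tau>) < 1" if "0 < t" for t
    using Q_stays_below_1[of \<tau> "t + \<tau>"] that \<open>\<tau> > 0\<close> Q\<tau> by simp
  have shift: "((\<lambda>t. g (t + \<tau>)) has_real_derivative g') (at t)"
    if "(g has_real_derivative g') (at (t + \<tau>))" for g g' t
    using that by (simp add: DERIV_shift)
  have "(p \<longlongrightarrow> 0) (at_right 0)"
    using tendsto_at_right_0[OF dp[of 0]] p0 by simp
  moreover have "((\<lambda>t. F' (t + \<tau>)) \<longlongrightarrow> F' (0 + \<tau>)) (at_right 0)"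
    by (rule tendsto_at_right_0, rule has_field_derivative_at_within, rule shift, rule F'_deriv)
       (use \<open>\<tau> > 0\<close> in simp)
  ultimately have "((\<lambda>t. F' (t + \<tau>) * p t) \<longlongrightarrow> F' (0 + \<tau>) * 0) (at_right 0)"
    by (intro tendsto_intros)
  then have lim: "((\<lambda>t. F' (t + \<tau>) * p t) \<longlongrightarrow> 0) (at_right 0)" by simp
  show False
  proof (rule sturm_comparison[of 0 z p p' "\<lambda>t. (Q (t + \<tau>))\<^sup>2" "\<lambda>t. F (t + \<tau>)" "\<lambda>t. F' (t + \<tau>)"
        "\<lambda>t. (Q (t + \<tau>))\<^sup>2 + Q (t + \<tau>)"])
    show "((\<lambda>t. F (t + \<tau>)) has_real_derivative F' (t + \<tau>)) (at t)" if "0 < t" for t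
      using that \<open>\<tau> > 0\<close> by (intro shift F_deriv) simp
    show "((\<lambda>t. F' (t + \<tau>)) has_real_derivative - ((Q (t + \<tau>))\<^sup>2 + Q (t + \<tau>)) * F (t + \<tau>)) (at t)"
      if "0 < t" for t
      using that \<open>\<tau> > 0\<close> by (intro shift F'_deriv) simp
    show "p t > 0 \<and> F (t + \<tau>) > 0 \<and> (Q (t + \<tau>))\<^sup>2 < (Q (t + \<tau>))\<^sup>2 + Q (t + \<tau>)" if "0 < t" "t < z" for t
      using z(3)[OF that] Q1[OF that(1)] Q_pos[of "t + \<tau>"] that \<open>\<tau> > 0\<close> by (auto simp: F_def)
    show "F (z + \<tau>) \<ge> 0" using Q1[of z] z(1) \<open>\<tau> > 0\<close> by (simp add: F_def)
    show "\<exists>\<xi>. 0 < \<xi> \<and> \<xi> < s \<and> F (\<xi> + \<tau>) * p' \<xi> - F' (\<xi> + \<tau>) * p \<xi> > - e" if "e > 0" "0 < s" for e s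
    proof -
      have "\<forall>\<^sub>F t in at_right 0. F' (t + \<tau>) * p t < e"
        using order_tendstoD(2)[OF lim] that by simp
      then obtain c where c: "c > 0" "\<And>t. t > 0 \<Longrightarrow> t < c \<Longrightarrow> F' (t + \<tau>) * p t < e"
        unfolding eventually_at_right_field by auto
      define r where "r = min (min c s) z / 2"
      have r: "0 < r" "r < c" "r < s" "r < z" using c(1) that z(1) by (auto simp: r_def)
      \<comment> \<open>Since p(r) > 0 = p(0), the mean value theorem yields a point with
        \<open>p' \<xi> > 0\<close>, so the first Wronskian term is positive; the subtracted one is
        below \<open>e\<close>.\<close>
      obtain \<xi> where \<xi>: "0 < \<xi>" "\<xi> < r" "p r - p 0 = (r - 0) * p' \<xi>"
      proof (rule mvt[of 0 r p "\<lambda>x h. h * p' x"])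
        show "continuous_on {0..r} p" by (rule continuous_on_subset[OF cp]) auto
        show "(p has_derivative (\<lambda>h. h * p' x)) (at x)" if "0 < x" "x < r" for x
          using dp1[OF that(1)] by (simp only: has_field_derivative_def mult_commute_abs)
      qed (use r in auto)
      have "p' \<xi> > 0" using \<xi>(3) z(3)[of r] r p0 by (simp add: zero_less_mult_iff)
      moreover have "F (\<xi> + \<tau>) > 0" using Q1[of \<xi>] \<xi> \<open>\<tau> > 0\<close> by (simp add: F_def)
      ultimately have "F (\<xi> + \<tau>) * p' \<xi> > 0" by simp
      then show ?thesis using c(2)[of \<xi>] \<xi> r by (intro exI[of _ \<xi>]) auto
    qed
  qed (use dp' dp1 z in auto)
qed

end

section \<open>Monotonicity of positive concave functions, and the conclusion\<close>

lemma pos_concave_imp_mono: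
  fixes p p' p'' :: "real \<Rightarrow> real"
  assumes dp: "\<And>t. t > 0 \<Longrightarrow> (p has_real_derivative p' t) (at t)"
    and dp': "\<And>t. t > 0 \<Longrightarrow> (p' has_real_derivative p'' t) (at t)"
    and concave: "\<And>t. t > 0 \<Longrightarrow> p'' t \<le> 0"
    and pos: "\<And>t. t > 0 \<Longrightarrow> p t > 0"
    and st: "0 < s" "s \<le> t"
  shows "p s \<le> p t"
proof -
  have p'_antimono: "p' y \<le> p' x" if "0 < x" "x \<le> y" for x y
    by (rule DERIV_nonpos_imp_nonincreasing[OF that(2)])
       (meson dp' concave that(1) less_le_trans)
  have p'_nonneg: "p' x \<ge> 0" if "x > 0" for x
  proof (rule ccontr)
    assume n: "\<not> p' x \<ge> 0"
    \<comment> \<open>The point where the tangent at \<open>x\<close> meets the axis; concavity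
      keeps \<open>p\<close> below this tangent, so p(y) \<le> 0.\<close>
    define y where "y = x - p x / p' x"
    have "x < y" using n pos[OF that] by (simp add: y_def divide_pos_neg)
    have "\<exists>\<xi>>x. \<xi> < y \<and> p y - p x = (y - x) * p' \<xi>"
      by (rule MVT2[OF \<open>x < y\<close>]) (use dp that in simp)
    then obtain \<xi> where \<xi>: "x < \<xi>" "\<xi> < y" "p y - p x = (y - x) * p' \<xi>"
      by blast
    have "(y - x) * p' \<xi> \<le> (y - x) * p' x"
      using p'_antimono[of x \<xi>] \<xi> that \<open>x < y\<close> by (intro mult_left_mono) auto
    also have "\<dots> = - p x" using n by (simp add: y_def)
    finally show False using \<xi>(3) pos[of y] \<open>x < y\<close> that by simp
  qed
  show ?thesis
    by (rule DERIV_nonneg_imp_nondecreasing[OF st(2)])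
       (meson dp p'_nonneg st(1) less_le_trans)
qed

theorem theorem7p1:
  fixes Q H0 p :: "real \<Rightarrow> real" and \<tau>0 :: real
  assumes "ground_state_profile Q"
    and "solves_lin_ode (\<lambda>t. - (Q t)\<^sup>2) H0 0 (-1)"
    and "\<tau>0 > 0" and "H0 \<tau>0 = 0" and "\<forall>t. 0 < t \<and> t < \<tau>0 \<longrightarrow> H0 t \<noteq> 0"
    and "solves_lin_ode (\<lambda>t. - (Q (t + \<tau>0))\<^sup>2) p 0 1"
  shows "(\<forall>t>0. p t > 0) \<and> (\<exists>c1>0. \<forall>t\<ge>1. p t \<ge> c1)"
proof -
  obtain Q' where "ground_state Q Q'"
    using assms(1) unfolding ground_state_profile_def ground_state_def by auto
  then interpret ground_state Q Q' .
  obtain H' where H: "\<And>t. t \<ge> 0 \<Longrightarrow> (H0 has_real_derivative H' t) (at t within {0..})"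
    "\<And>t. t > 0 \<Longrightarrow> (H' has_real_derivative - (Q t)\<^sup>2 * H0 t) (at t)" "H0 0 = 0" "H' 0 = - 1"
    using assms(2) unfolding solves_lin_ode_def by auto
  obtain p' where p: "\<And>t. t \<ge> 0 \<Longrightarrow> (p has_real_derivative p' t) (at t within {0..})"
    "\<And>t. t > 0 \<Longrightarrow> (p' has_real_derivative - (Q (t + \<tau>0))\<^sup>2 * p t) (at t)" "p 0 = 0" "p' 0 = 1"
    using assms(6) unfolding solves_lin_ode_def by auto
  \<comment> \<open>The sign flip gives initial slope 1, hence a solution positive up to its first
    zero \<open>\<tau>0\<close>.\<close>
  define y where "y t = - H0 t" for t
  have dy: "(y has_real_derivative - H' t) (at t within {0..})" if "t \<ge> 0" for t
    unfolding y_def using H(1)[OF that] by (rule DERIV_minus)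
  have dy': "((\<lambda>t. - H' t) has_real_derivative - (Q t)\<^sup>2 * y t) (at t)" if "t > 0" for t
    using DERIV_minus[OF H(2)[OF that]] by (simp add: y_def)
  have y0: "y 0 = 0" by (simp add: y_def H)
  have cy: "continuous_on {0..} y" using dy by (intro DERIV_continuous_on) auto
  obtain d where d: "d > 0" "\<And>t. 0 < t \<Longrightarrow> t < d \<Longrightarrow> y t > 0"
    using pos_right_if_deriv_pos[OF dy[of 0] y0] H(4) by auto
  have y_pos: "y t > 0" if "0 < t" "t < \<tau>0" for t
    by (rule pos_if_no_zero[OF cy d _ that]) (use assms(5) in \<open>auto simp: y_def\<close>)
  have "Q \<tau>0 \<le> 1"
    by (rule Q_le_1_at_zero[OF dy dy' y0 assms(3) _ y_pos]) (use assms(4) in \<open>auto simp: y_def\<close>)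
  then have pos: "p t > 0" if "t > 0" for t
    using shifted_solution_pos[OF p(1-3) _ assms(3) _ that] p(4) by simp
  \<comment> \<open>Positivity of \<open>p\<close> makes p'' = -Q^2 p nonpositive, so
    \<open>p\<close> is concave and nondecreasing and c1 = p(1) serves.\<close>
  have "p 1 \<le> p t" if "t \<ge> 1" for t
  proof (rule pos_concave_imp_mono[of p p' "\<lambda>t. - (Q (t + \<tau>0))\<^sup>2 * p t"])
    show "(p has_real_derivative p' t) (at t)" if "t > 0" for t
      using p(1)[of t] that by (simp add: at_within_Ici_pos)
    show "- (Q (t + \<tau>0))\<^sup>2 * p t \<le> 0" if "t > 0" for t
      using pos[OF that] by simp
  qed (use p(2) pos that in auto)
  then show ?thesis using pos by (intro conjI allI impI exI[of _ "p 1"]) auto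
qed

end
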